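(* For the path $P_n$ on $n\ge 2$ vertices, $C_{tr}(P_n)=2$ if $2\le n\le 7$, and $C_{tr}(P_n)=3$ if $n\ge 8$.
   Context: A set $S\subseteq V$ is a total restrained dominating set (TRD-set) of $G=(V,E)$ if every vertex of $V\setminus S$ is adjacent to at least one vertex of $S$ and to at least one other vertex of $V\setminus S$, and every vertex of $S$ is adjacent to at least one other vertex of $S$. Two disjoint sets $X,Y\subseteq V$ form a total restrained coalition if neither is a TRD-set but $X\cup Y$ is a TRD-set. A trc-partition of $G$ is a partition $\Phi$ of $V$ such that no member of $\Phi$ is a TRD-set and each member forms a total restrained coalition with some other member of $\Phi$. $C_{tr}(G)$ is the maximum cardinality of a trc-partition of $G$. *)

theory Defs
  imports Main "HOL-Library.Disjoint_Sets"
begin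

text \<open>A graph is given by a vertex set \<open>V\<close> and a set \<open>E\<close> of edges, each edge being a
  two-element subset of \<open>V\<close>.\<close>

definition simple_graph :: "'a set \<Rightarrow> 'a set set \<Rightarrow> bool" where
  "simple_graph V E \<longleftrightarrow> finite V \<and> (\<forall>e\<in>E. e \<subseteq> V \<and> card e = 2)"

definition adjacent :: "'a set set \<Rightarrow> 'a \<Rightarrow> 'a \<Rightarrow> bool" where
  "adjacent E u v \<longleftrightarrow> {u, v} \<in> E"

definition trd_set :: "'a set \<Rightarrow> 'a set set \<Rightarrow> 'a set \<Rightarrow> bool" where
  "trd_set V E S \<longleftrightarrow> S \<subseteq> V
     \<and> (\<forall>v\<in>V - S. (\<exists>u\<in>S. adjacent E v u) \<and> (\<exists>w\<in>V - S. w \<noteq> v \<and> adjacent E v w))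
     \<and> (\<forall>v\<in>S. \<exists>u\<in>S. u \<noteq> v \<and> adjacent E v u)"

definition tr_coalition :: "'a set \<Rightarrow> 'a set set \<Rightarrow> 'a set \<Rightarrow> 'a set \<Rightarrow> bool" where
  "tr_coalition V E X Y \<longleftrightarrow> X \<subseteq> V \<and> Y \<subseteq> V \<and> X \<inter> Y = {}
     \<and> \<not> trd_set V E X \<and> \<not> trd_set V E Y \<and> trd_set V E (X \<union> Y)"

definition trc_partition :: "'a set \<Rightarrow> 'a set set \<Rightarrow> 'a set set \<Rightarrow> bool" where
  "trc_partition V E \<Phi> \<longleftrightarrow> partition_on V \<Phi>
     \<and> (\<forall>X\<in>\<Phi>. \<not> trd_set V E X)
     \<and> (\<forall>X\<in>\<Phi>. \<exists>Y\<in>\<Phi>. Y \<noteq> X \<and> tr_coalition V E X Y)"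

text \<open>The set of cardinalities below is finite when \<open>V\<close> is finite. If \<open>(V, E)\<close> has no
  trc-partition, the set is empty and the value of \<open>Max\<close> is unspecified.\<close>

definition C_tr :: "'a set \<Rightarrow> 'a set set \<Rightarrow> nat" where
  "C_tr V E = Max {card \<Phi> | \<Phi>. trc_partition V E \<Phi>}"

definition path_verts :: "nat \<Rightarrow> nat set" where
  "path_verts n = {1..n}"

definition path_edges :: "nat \<Rightarrow> nat set set" where
  "path_edges n = {{i, i + 1} | i. 1 \<le> i \<and> i < n}"

lemma simple_graph_path: "simple_graph (path_verts n) (path_edges n)"
  by (auto simp: simple_graph_def path_verts_def path_edges_def)

lemma finite_trc_partition_cards:
  assumes "finite V"
  shows "finite {card \<Phi> | \<Phi>. trc_partition V E \<Phi>}"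
proof -
  have "{\<Phi>. trc_partition V E \<Phi>} \<subseteq> Pow (Pow V)"
    by (auto simp: trc_partition_def partition_on_def)
  then have "finite {\<Phi>. trc_partition V E \<Phi>}"
    using assms by (simp add: finite_subset)
  then show ?thesis by simp
qed

end

theory Submission
  imports Defs
begin

text \<open>Each end vertex of the path lies in every TRD-set together with its neighbour. Hence in a
  trc-partition the class \<open>X\<close> containing vertex \<open>1\<close> is the partner of every other class. If there
  were three other classes \<open>Y\<close>, every vertex without a neighbour in \<open>X\<close> would need neighbours in
  three different classes, since each \<open>X \<union> Y\<close> is a TRD-set; as degrees are at most two, \<open>X\<close> itself
  would be a TRD-set. With exactly two other classes, both avoid \<open>1, 2, n - 1, n\<close> and have at least
  two elements, so that \<open>n \<ge> 8\<close>. For \<open>n \<ge> 8\<close> the classes \<open>{3, 4}\<close>, \<open>{5, 6}\<close> and the rest work.\<close>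

section \<open>Leaves and bounded degree in arbitrary graphs\<close>

lemma trd_set_leaf:
  assumes "trd_set V E S" "l \<in> V" "\<And>w. adjacent E l w \<Longrightarrow> w = u"
  shows "l \<in> S" "u \<in> S"
  using assms unfolding trd_set_def by (metis DiffD2 DiffI)+

text \<open>A coalition union is a TRD-set and so contains \<open>l\<close>; a class missing
  \<open>l\<close> can therefore only have the class of \<open>l\<close> as partner. That class is
  the \<open>X\<close> obtained.\<close>

lemma trc_partition_leaf_class:
  assumes P: "trc_partition V E \<Phi>" and "l \<in> V" "\<And>w. adjacent E l w \<Longrightarrow> w = u"
  obtains X where "X \<in> \<Phi>" "\<And>Y. Y \<in> \<Phi> - {X} \<Longrightarrow> trd_set V E (X \<union> Y)"
proof -
  have part: "partition_on V \<Phi>" using P by (simp add: trc_partition_def)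
  obtain X where X: "X \<in> \<Phi>" "l \<in> X"
    using partition_onD1[OF part] \<open>l \<in> V\<close> by blast
  have "trd_set V E (X \<union> Y)" if Y: "Y \<in> \<Phi> - {X}" for Y
  proof -
    obtain Z where Z: "Z \<in> \<Phi>" "trd_set V E (Y \<union> Z)"
      using P Y unfolding trc_partition_def tr_coalition_def by blast
    have "l \<in> Y \<union> Z"
      using trd_set_leaf(1)[OF Z(2) assms(2,3)] .
    moreover have "l \<notin> Y"
      using partition_onD2[OF part] X Y by (auto simp: disjoint_def)
    ultimately have "Z = X"
      using partition_onD2[OF part] X Z(1) by (auto simp: disjoint_def)
    then show ?thesis using Z(2) by (simp add: Un_commute)
  qed
  with X(1) show ?thesis using that by blast
qed

text \<open>A vertex without a neighbour in \<open>X\<close> would have one in each of three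
  disjoint classes, against \<open>deg\<close>, which says "at most two neighbours" without
  cardinalities. Restrainedness of \<open>X\<close> is inherited from a union
  \<open>X \<union> Y\<close> that misses the given vertex.\<close>

lemma trd_set_if_three_unions:
  assumes part: "partition_on V \<Phi>" and X: "X \<in> \<Phi>"
    and trd: "\<And>Y. Y \<in> \<Phi> - {X} \<Longrightarrow> trd_set V E (X \<union> Y)"
    and card: "card (\<Phi> - {X}) \<ge> 3"
    and deg: "\<And>v a b c. adjacent E v a \<Longrightarrow> adjacent E v b \<Longrightarrow> adjacent E v c \<Longrightarrow> a = b \<or> a = c \<or> b = c"
    and loopless: "\<And>v. \<not> adjacent E v v"
  shows "trd_set V E X"
proof -
  have disj: "A \<inter> B = {}" if "A \<in> \<Phi>" "B \<in> \<Phi>" "A \<noteq> B" for A B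
    using partition_onD2[OF part] that by (auto simp: disjoint_def)
  obtain T where T: "T \<subseteq> \<Phi> - {X}" "card T = 3"
    using obtain_subset_with_card_n[OF card] by metis
  obtain A B C where "T = {A, B, C}" and ne: "A \<noteq> B" "A \<noteq> C" "B \<noteq> C"
    using T(2) unfolding card_3_iff by metis
  with T(1) have ABC: "A \<in> \<Phi> - {X}" "B \<in> \<Phi> - {X}" "C \<in> \<Phi> - {X}" by simp_all
  have nbr: "\<exists>u\<in>X \<union> Y. adjacent E v u" if "Y \<in> \<Phi> - {X}" "v \<in> V" for Y v
    using trd[OF that(1)] that(2) unfolding trd_set_def by blast
  have nbrX: "\<exists>u\<in>X. adjacent E v u" if v: "v \<in> V" for v
  proof (rule ccontr)
    assume "\<not> ?thesis"
    then have *: "\<exists>u\<in>Y. adjacent E v u" if "Y \<in> \<Phi> - {X}" for Y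
      using nbr[OF that v] by blast
    obtain a b c where abc: "a \<in> A" "b \<in> B" "c \<in> C"
      and "adjacent E v a" "adjacent E v b" "adjacent E v c"
      using *[OF ABC(1)] *[OF ABC(2)] *[OF ABC(3)] by (elim bexE)
    then have "a = b \<or> a = c \<or> b = c" by (intro deg)
    moreover have "A \<inter> B = {}" "A \<inter> C = {}" "B \<inter> C = {}"
      using ABC ne by (simp_all add: disj)
    ultimately show False using abc by blast
  qed
  have out: "\<exists>w\<in>V - X. w \<noteq> v \<and> adjacent E v w" if v: "v \<in> V - X" for v
  proof -
    \<comment> \<open>\<open>v\<close> lies in at most one of \<open>A\<close> and \<open>B\<close>.
      For the other, \<open>Z\<close>, it is outside \<open>X \<union> Z\<close>, and its neighbour
      outside \<open>X \<union> Z\<close> is also outside \<open>X\<close>.\<close>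
    have "A \<inter> B = {}" using ABC ne by (simp add: disj)
    then obtain Z where Z: "Z \<in> \<Phi> - {X}" "v \<notin> Z"
      using ABC(1,2) by blast
    then show ?thesis
      using trd[OF Z(1)] v unfolding trd_set_def by blast
  qed
  have XV: "X \<subseteq> V" using partition_onD1[OF part] X by blast
  show ?thesis
    unfolding trd_set_def
  proof (intro conjI ballI)
    fix v assume "v \<in> X"
    then obtain u where "u \<in> X" "adjacent E v u" using nbrX XV by blast
    moreover from this(2) have "u \<noteq> v" using loopless by blast
    ultimately show "\<exists>u\<in>X. u \<noteq> v \<and> adjacent E v u" by blast
  next
    fix v assume v: "v \<in> V - X"
    show "\<exists>u\<in>X. adjacent E v u" using v by (intro nbrX) simp
    show "\<exists>w\<in>V - X. w \<noteq> v \<and> adjacent E v w" using v by (rule out)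
  qed (fact XV)
qed

section \<open>Upper bounds for paths\<close>

lemma adjacent_path_edges:
  "adjacent (path_edges n) u v \<longleftrightarrow> 1 \<le> u \<and> 1 \<le> v \<and> u \<le> n \<and> v \<le> n \<and> (v = Suc u \<or> u = Suc v)"
  by (auto simp: adjacent_def path_edges_def doubleton_eq_iff)

lemma trd_set_path_ends:
  assumes "n \<ge> 2" "trd_set (path_verts n) (path_edges n) S"
  shows "1 \<in> S" "2 \<in> S" "n - 1 \<in> S" "n \<in> S"
proof -
  have "1 \<in> path_verts n" "n \<in> path_verts n"
    using assms(1) by (auto simp: path_verts_def)
  moreover have "adjacent (path_edges n) 1 w \<Longrightarrow> w = 2" "adjacent (path_edges n) n w \<Longrightarrow> w = n - 1" for w
    by (auto simp: adjacent_path_edges)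
  ultimately show "1 \<in> S" "2 \<in> S" "n - 1 \<in> S" "n \<in> S"
    using trd_set_leaf[OF assms(2)] by blast+
qed

lemma trc_partition_path_center:
  assumes "n \<ge> 2" "trc_partition (path_verts n) (path_edges n) \<Phi>"
  obtains X where "X \<in> \<Phi>" "\<And>Y. Y \<in> \<Phi> - {X} \<Longrightarrow> trd_set (path_verts n) (path_edges n) (X \<union> Y)"
proof -
  have "1 \<in> path_verts n" using assms(1) by (simp add: path_verts_def)
  moreover have "w = 2" if "adjacent (path_edges n) 1 w" for w
    using that by (auto simp: adjacent_path_edges)
  ultimately show thesis
    by (rule trc_partition_leaf_class[OF assms(2) _ _ that])
qed

lemma card_trc_partition_path_le_3:
  assumes n: "n \<ge> 2" and P: "trc_partition (path_verts n) (path_edges n) \<Phi>"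
  shows "card \<Phi> \<le> 3"
proof (rule ccontr)
  assume "\<not> card \<Phi> \<le> 3"
  moreover obtain X where X: "X \<in> \<Phi>"
    and trd: "\<And>Y. Y \<in> \<Phi> - {X} \<Longrightarrow> trd_set (path_verts n) (path_edges n) (X \<union> Y)"
    using trc_partition_path_center[OF n P] by blast
  ultimately have "card (\<Phi> - {X}) \<ge> 3" by simp
  moreover have "partition_on (path_verts n) \<Phi>"
    using P by (simp add: trc_partition_def)
  ultimately have "trd_set (path_verts n) (path_edges n) X"
    using X trd by (rule_tac trd_set_if_three_unions) (auto simp: adjacent_path_edges)
  then show False using P X by (simp add: trc_partition_def)
qed

text \<open>If \<open>n \<le> 7\<close>, the two classes other than the center fit into
  \<open>{3, 4, 5}\<close>. Each is the nonempty complement of a TRD-set and needs two elements,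
  four in all.\<close>

lemma trc_partition_path_card_3_imp:
  assumes n: "n \<ge> 2" and P: "trc_partition (path_verts n) (path_edges n) \<Phi>" and card: "card \<Phi> = 3"
  shows "n \<ge> 8"
proof (rule ccontr)
  assume small: "\<not> n \<ge> 8"
  obtain X where X: "X \<in> \<Phi>"
    and trd: "\<And>Y. Y \<in> \<Phi> - {X} \<Longrightarrow> trd_set (path_verts n) (path_edges n) (X \<union> Y)"
    using trc_partition_path_center[OF n P] by blast
  have "card (\<Phi> - {X}) = 2" using card X by simp
  then obtain Y Z where YZ: "\<Phi> - {X} = {Y, Z}" "Y \<noteq> Z" by (auto simp: card_2_iff)
  have part: "partition_on (path_verts n) \<Phi>" using P by (simp add: trc_partition_def)
  have mem: "Y \<in> \<Phi>" "Z \<in> \<Phi>" "X \<noteq> Y" "X \<noteq> Z" using YZ by auto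
  have disj: "X \<inter> Y = {}" "X \<inter> Z = {}" "Y \<inter> Z = {}"
    using partition_onD2[OF part] X mem YZ(2) by (auto simp: disjoint_def)
  have V: "path_verts n = X \<union> Y \<union> Z"
    using partition_onD1[OF part] X YZ by blast
  have tY: "trd_set (path_verts n) (path_edges n) (X \<union> Y)"
    and tZ: "trd_set (path_verts n) (path_edges n) (X \<union> Z)"
    using trd YZ by auto
  \<comment> \<open>These vertices lie in both \<open>X \<union> Y\<close> and
    \<open>X \<union> Z\<close>, whose intersection is \<open>X\<close>.\<close>
  have "{1, 2, n - 1, n} \<subseteq> X"
    using trd_set_path_ends[OF n tY] trd_set_path_ends[OF n tZ] disj by blast
  moreover have "{1..n} \<subseteq> {1, 2, n - 1, n} \<union> {3, 4, 5}"
    using small by auto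
  moreover have "Y \<union> Z = {1..n} - X"
    using V disj by (auto simp: path_verts_def)
  ultimately have sub: "Y \<union> Z \<subseteq> {3, 4, 5}" by blast
  then have fin: "finite Y" "finite Z" by (auto intro: finite_subset)
  \<comment> \<open>A vertex outside a TRD-set has another outside vertex as neighbour.\<close>
  have two: "2 \<le> card B"
    if B: "trd_set (path_verts n) (path_edges n) A" "path_verts n - A = B" "B \<noteq> {}" "finite B" for A B
  proof -
    obtain v w where "v \<in> B" "w \<in> B" "w \<noteq> v"
      using B unfolding trd_set_def by blast
    then show ?thesis
      using card_mono[of B "{v, w}"] B(4) by auto
  qed
  have "path_verts n - (X \<union> Z) = Y" "path_verts n - (X \<union> Y) = Z"
    using V disj by auto
  moreover have "Y \<noteq> {}" "Z \<noteq> {}"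
    using partition_onD3[OF part] mem by auto
  ultimately have "2 \<le> card Y" "2 \<le> card Z"
    using two[OF tZ] two[OF tY] fin by simp_all
  moreover have "card (Y \<union> Z) = card Y + card Z"
    using fin disj by (intro card_Un_disjoint)
  moreover have "card (Y \<union> Z) \<le> 3"
    using card_mono[OF _ sub] by simp
  ultimately show False by simp
qed

section \<open>Constructions attaining the bounds\<close>

lemma tr_coalition_commute: "tr_coalition V E X Y \<longleftrightarrow> tr_coalition V E Y X"
  by (auto simp: tr_coalition_def Un_commute)

text \<open>The whole vertex set is a TRD-set because no vertex is isolated, whereas
  \<open>{1}\<close> misses vertex \<open>2\<close> and \<open>{2..n}\<close> misses vertex
  \<open>1\<close>.\<close>

lemma trc_partition_path_2:
  assumes n: "n \<ge> 2"
  shows "trc_partition (path_verts n) (path_edges n) {{1}, {2..n}}"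
proof -
  have "{1} \<union> {2..n} = {1..n}" using n by auto
  moreover have "trd_set (path_verts n) (path_edges n) {1..n}"
    unfolding trd_set_def path_verts_def adjacent_path_edges
  proof (intro conjI ballI)
    fix v assume "v \<in> {1..n}"
    then show "\<exists>u\<in>{1..n}. u \<noteq> v \<and> 1 \<le> v \<and> 1 \<le> u \<and> v \<le> n \<and> u \<le> n \<and> (u = Suc v \<or> v = Suc u)"
      using n by (intro bexI[of _ "if v = 1 then 2 else v - 1"]) auto
  qed auto
  moreover have "\<not> trd_set (path_verts n) (path_edges n) {1}"
    using trd_set_path_ends(2)[OF n, of "{1}"] by auto
  moreover have "\<not> trd_set (path_verts n) (path_edges n) {2..n}"
    using trd_set_path_ends(1)[OF n, of "{2..n}"] by auto
  ultimately have "tr_coalition (path_verts n) (path_edges n) {1} {2..n}"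
    using n by (auto simp: tr_coalition_def path_verts_def)
  moreover from this have "tr_coalition (path_verts n) (path_edges n) {2..n} {1}"
    by (simp add: tr_coalition_commute)
  moreover have "partition_on (path_verts n) {{1}, {2..n}}"
    using n by (auto simp: partition_on_def disjoint_def path_verts_def)
  moreover have "1 \<notin> {2..n}" by simp
  then have "{1} \<noteq> {2..n}" "{2..n} \<noteq> {1}" by blast+
  ultimately show ?thesis
    by (simp add: trc_partition_def tr_coalition_def)
qed

text \<open>The removed vertices are each other's outside neighbour and have \<open>i - 1\<close>
  and \<open>i + 2\<close> as inside neighbours. The bounds on \<open>i\<close> leave at least two
  vertices on either side, so no remaining vertex is isolated.\<close>

lemma trd_set_path_remove_pair:
  assumes i: "i \<ge> 3" "i + 3 \<le> n"
  shows "trd_set (path_verts n) (path_edges n) ({1..n} - {i, Suc i})"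
  unfolding trd_set_def path_verts_def adjacent_path_edges
proof (intro conjI ballI)
  fix v assume "v \<in> {1..n} - ({1..n} - {i, Suc i})"
  then have v: "v = i \<or> v = Suc i" by auto
  show "\<exists>u\<in>{1..n} - {i, Suc i}. 1 \<le> v \<and> 1 \<le> u \<and> v \<le> n \<and> u \<le> n \<and> (u = Suc v \<or> v = Suc u)"
    using v i by (intro bexI[of _ "if v = i then i - 1 else Suc (Suc i)"]) auto
  show "\<exists>w\<in>{1..n} - ({1..n} - {i, Suc i}).
      w \<noteq> v \<and> 1 \<le> v \<and> 1 \<le> w \<and> v \<le> n \<and> w \<le> n \<and> (w = Suc v \<or> v = Suc w)"
    using v i by (intro bexI[of _ "if v = i then Suc i else i"]) auto
next
  fix v assume "v \<in> {1..n} - {i, Suc i}"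
  then show "\<exists>u\<in>{1..n} - {i, Suc i}.
      u \<noteq> v \<and> 1 \<le> v \<and> 1 \<le> u \<and> v \<le> n \<and> u \<le> n \<and> (u = Suc v \<or> v = Suc u)"
    \<comment> \<open>The predecessor works except at the left ends \<open>1\<close> and
      \<open>i + 2\<close> of the two remaining segments.\<close>
    using i by (intro bexI[of _ "if v = 1 \<or> v = i + 2 then Suc v else v - 1"]) auto
qed auto

text \<open>Joining the large class with one pair leaves out just the other pair, so pair removal
  applies with \<open>i = 5\<close> and \<open>i = 3\<close>; the former requires
  \<open>n \<ge> 8\<close>.\<close>

lemma trc_partition_path_3:
  assumes n: "n \<ge> 8"
  shows "trc_partition (path_verts n) (path_edges n) {{1..n} - {3, 4, 5, 6}, {3, 4}, {5, 6}}"
proof -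
  let ?V = "path_verts n" and ?E = "path_edges n" and ?X = "{1..n} - {3, 4, 5, 6}"
  have n2: "n \<ge> 2" using n by simp
  have "?X \<union> {3, 4} = {1..n} - {5, Suc 5}" "?X \<union> {5, 6} = {1..n} - {3, Suc 3}"
    using n by auto
  then have t: "trd_set ?V ?E (?X \<union> {3, 4})" "trd_set ?V ?E (?X \<union> {5, 6})"
    using trd_set_path_remove_pair[of 5 n] trd_set_path_remove_pair[of 3 n] n by auto
  have "\<not> trd_set ?V ?E {3, 4}" "\<not> trd_set ?V ?E {5, 6}"
    using trd_set_path_ends(1)[OF n2, of "{3, 4}"] trd_set_path_ends(1)[OF n2, of "{5, 6}"] by auto
  moreover have "\<not> trd_set ?V ?E ?X"
  proof
    assume "trd_set ?V ?E ?X"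
    \<comment> \<open>Both neighbours of \<open>4\<close>, namely \<open>3\<close> and
      \<open>5\<close>, are outside \<open>?X\<close>.\<close>
    moreover have "4 \<in> ?V - ?X" using n by (auto simp: path_verts_def)
    ultimately obtain u where "u \<in> ?X" "adjacent ?E 4 u"
      unfolding trd_set_def by blast
    then show False by (auto simp: adjacent_path_edges)
  qed
  ultimately have "tr_coalition ?V ?E ?X {3, 4}" "tr_coalition ?V ?E ?X {5, 6}"
    using n t by (auto simp: tr_coalition_def path_verts_def)
  moreover from this have "tr_coalition ?V ?E {3, 4} ?X" "tr_coalition ?V ?E {5, 6} ?X"
    by (simp_all add: tr_coalition_commute)
  moreover have "1 \<in> ?X" using n by auto
  then have "?X \<noteq> {3, 4}" "?X \<noteq> {5, 6}" "?X \<noteq> {}" by auto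
  moreover from this(3) have "partition_on ?V {?X, {3, 4}, {5, 6}}"
    using n by (auto simp: partition_on_def disjoint_def path_verts_def)
  ultimately show ?thesis
    by (simp add: trc_partition_def tr_coalition_def)
qed

text \<open>\<open>Max\<close> is well defined here: \<open>V\<close> is finite, and
  \<open>\<Phi>\<close> makes the set of cardinalities nonempty.\<close>

lemma C_tr_eqI:
  assumes "finite V" "trc_partition V E \<Phi>" "card \<Phi> = k" "\<And>\<Psi>. trc_partition V E \<Psi> \<Longrightarrow> card \<Psi> \<le> k"
  shows "C_tr V E = k"
  unfolding C_tr_def using assms by (intro Max_eqI finite_trc_partition_cards) auto

theorem theorem3p8:
  fixes n :: nat
  assumes "n \<ge> 2"
  shows "(n \<le> 7 \<longrightarrow> C_tr (path_verts n) (path_edges n) = 2) \<and>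
         (n \<ge> 8 \<longrightarrow> C_tr (path_verts n) (path_edges n) = 3)"
proof (intro conjI impI)
  have fin: "finite (path_verts n)" by (simp add: path_verts_def)
  {
    assume "n \<le> 7"
    have "1 \<notin> {2..n}" by simp
    then have "{1} \<noteq> {2..n}" by blast
    then have "card {{1}, {2..n}} = 2" by simp
    \<comment> \<open>The general bound is 3, and the value 3 would force
      \<open>n \<ge> 8\<close>.\<close>
    moreover have "card \<Psi> \<le> 2" if "trc_partition (path_verts n) (path_edges n) \<Psi>" for \<Psi>
      using card_trc_partition_path_le_3[OF assms that] trc_partition_path_card_3_imp[OF assms that] \<open>n \<le> 7\<close>
      by linarith
    ultimately show "C_tr (path_verts n) (path_edges n) = 2"
      by (intro C_tr_eqI[OF fin trc_partition_path_2[OF assms]])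
  next
    assume n: "n \<ge> 8"
    have "1 \<in> {1..n} - {3, 4, 5, 6}" using n by auto
    then have "{1..n} - {3, 4, 5, 6} \<noteq> {3, 4}" "{1..n} - {3, 4, 5, 6} \<noteq> {5, 6}" by auto
    moreover have "{3, 4} \<noteq> {5, 6 :: nat}" by auto
    ultimately have "card {{1..n} - {3, 4, 5, 6}, {3, 4}, {5, 6}} = 3" by simp
    then show "C_tr (path_verts n) (path_edges n) = 3"
      by (intro C_tr_eqI[OF fin trc_partition_path_3[OF n]] card_trc_partition_path_le_3[OF assms])
  }
qed

end
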